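(* Every forest is Hall-universal.
   Context: All graphs are finite and simple. For a finite set $V$, $\mathcal G(V)$ denotes the set of all finite simple undirected graphs with vertex set $V$, and $N_G(v)$ is the (open) neighborhood of $v$ in $G$. List coloring: for a graph $H$, a set of colors $S$ and $L:V(H)\to 2^S$, $H$ is $L$-colorable if there is a map $\varphi:V(H)\to S$ with $\varphi(v)\in L(v)$ for all $v$ and $\varphi(u)\ne\varphi(v)$ for every edge $uv\in E(H)$. For a subgraph $F$ of $H$ and $\sigma\in S$, $\alpha(F,L,\sigma)$ is the maximum size of an independent set $X\subseteq V(F)$ of $F$ with $\sigma\in L(v)$ for all $v\in X$. The pair $(H,L)$ satisfies Hall's condition if $|V(F)|\le\sum_{\sigma\in S}\alpha(F,L,\sigma)$ for every subgraph $F$ of $H$. Graphic lists: for $G,H\in\mathcal G(V)$, let $L(v)=N_G(v)$ for all $v\in V$ (with color set $S=V$). $H$ is $G$-colorable if $H$ is $L$-colorable, and $(H,G)$ satisfies Hall's condition if $(H,L)$ does. A graph $G\in\mathcal G(V)$ is Hall-universal if, for every $H\in\mathcal G(V)$ such that $(H,G)$ satisfies Hall's condition, $H$ is $G$-colorable. *)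

theory Defs
  imports "Graph_Theory.Digraph_Component"
begin

text \<open>
  Finite simple undirected graphs are modelled, as in the entry Graph_Theory, by the locale
  predicate \<^const>\<open>pair_graph\<close>: a finite vertex set with a finite, symmetric, irreflexive
  relation on it. An undirected edge $uv$ is the pair of arcs $(u,v)$, $(v,u)$.
\<close>

definition graphs_on :: "'a set \<Rightarrow> 'a pair_pre_digraph set" where
  "graphs_on V = {G. pair_graph G \<and> pverts G = V}"

definition nbhd :: "'a pair_pre_digraph \<Rightarrow> 'a \<Rightarrow> 'a set" where
  "nbhd G v = {w. (v, w) \<in> parcs G}"

text \<open>
  Subgraphs of an undirected graph have to be undirected graphs themselves, whereas
  \<^const>\<open>subgraph\<close> alone would also admit asymmetric sets of arcs.
\<close>

definition undirected_subgraph :: "'a pair_pre_digraph \<Rightarrow> 'a pair_pre_digraph \<Rightarrow> bool" where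
  "undirected_subgraph F H \<longleftrightarrow> pair_graph F \<and> subgraph (with_proj F) (with_proj H)"

text \<open>
  The library's \<^const>\<open>forest\<close> is not usable here: in a symmetric digraph every edge
  $uv$ yields the directed cycle $u, v, u$, so only edgeless graphs would qualify.
  The cycles of an undirected simple graph are the directed cycles of length at least 3.
\<close>

definition undirected_forest :: "'a pair_pre_digraph \<Rightarrow> bool" where
  "undirected_forest G \<longleftrightarrow>
     pair_graph G \<and> \<not> (\<exists>p. pre_digraph.cycle (with_proj G) p \<and> 3 \<le> length p)"

definition list_colorable :: "'c set \<Rightarrow> 'a pair_pre_digraph \<Rightarrow> ('a \<Rightarrow> 'c set) \<Rightarrow> bool" where
  "list_colorable S H L \<longleftrightarrow>
     (\<exists>\<phi>. (\<forall>v\<in>pverts H. \<phi> v \<in> S \<and> \<phi> v \<in> L v) \<and> (\<forall>(u, v)\<in>parcs H. \<phi> u \<noteq> \<phi> v))"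

definition independent_in :: "'a pair_pre_digraph \<Rightarrow> 'a set \<Rightarrow> bool" where
  "independent_in F X \<longleftrightarrow> X \<subseteq> pverts F \<and> (\<forall>u\<in>X. \<forall>v\<in>X. (u, v) \<notin> parcs F)"

definition color_alpha :: "'a pair_pre_digraph \<Rightarrow> ('a \<Rightarrow> 'c set) \<Rightarrow> 'c \<Rightarrow> nat" where
  "color_alpha F L \<sigma> = Max (card ` {X. independent_in F X \<and> (\<forall>v\<in>X. \<sigma> \<in> L v)})"

text \<open>The color set \<open>S\<close> is meant to be finite, since the sum over an infinite set is 0.\<close>

definition hall_condition :: "'c set \<Rightarrow> 'a pair_pre_digraph \<Rightarrow> ('a \<Rightarrow> 'c set) \<Rightarrow> bool" where
  "hall_condition S H L \<longleftrightarrow>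
     (\<forall>F. undirected_subgraph F H \<longrightarrow> card (pverts F) \<le> (\<Sum>\<sigma>\<in>S. color_alpha F L \<sigma>))"

definition graph_colorable :: "'a pair_pre_digraph \<Rightarrow> 'a pair_pre_digraph \<Rightarrow> bool" where
  "graph_colorable H G \<longleftrightarrow> list_colorable (pverts G) H (nbhd G)"

definition graph_hall_condition :: "'a pair_pre_digraph \<Rightarrow> 'a pair_pre_digraph \<Rightarrow> bool" where
  "graph_hall_condition H G \<longleftrightarrow> hall_condition (pverts G) H (nbhd G)"

definition hall_universal :: "'a pair_pre_digraph \<Rightarrow> bool" where
  "hall_universal G \<longleftrightarrow>
     (\<forall>H\<in>graphs_on (pverts G). graph_hall_condition H G \<longrightarrow> graph_colorable H G)"

end

theory Submission
  imports Defs
begin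

text \<open>
  The forest \<open>G\<close> matters only through its lists: a color \<open>\<sigma>\<close> is available at the vertices of
  \<open>V\<^sub>\<sigma> = N\<^sub>G(\<sigma>)\<close>. Since \<open>G\<close> is a forest, it admits no endless non-backtracking walk
  (\<open>forest_no_nonbacktracking\<close>). Hence, for any remaining set \<open>W\<close> of vertices and any nonempty
  remaining set \<open>S\<close> of colors, there is a color \<open>\<sigma> \<in> S\<close> such that all vertices of
  \<open>W \<inter> V\<^sub>\<sigma>\<close>, except for at most one vertex \<open>u\<close>, have \<open>\<sigma>\<close> as their only color in \<open>S\<close>
  (\<open>forest_private_color\<close>): otherwise one could alternate forever between \<open>S\<close> and the vertices
  that see at least two colors of \<open>S\<close>.

  The coloring is then built by induction on \<open>S\<close> (\<open>coloring_of_private_colors\<close>). Let \<open>U\<close> be the set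
  of vertices of \<open>W\<close> other than \<open>u\<close> in \<open>V\<^sub>\<sigma>\<close>. Hall's condition for \<open>U\<close>, where only \<open>\<sigma>\<close>
  contributes, says that \<open>U\<close> is independent. Thus \<open>W \<inter> V\<^sub>\<sigma>\<close> has a maximum independent subset
  \<open>D \<supseteq> U\<close>, namely the whole set or \<open>U\<close>. All of \<open>D\<close> receives color \<open>\<sigma>\<close>, and \<open>D\<close> and \<open>\<sigma>\<close> are
  discarded. Hall's condition survives for every \<open>X \<subseteq> W - D\<close>. If \<open>D = W \<inter> V\<^sub>\<sigma>\<close>, then \<open>\<sigma>\<close>
  contributes nothing to \<open>X\<close>, and the old condition for \<open>X\<close> suffices. If \<open>D = U\<close>, the old condition for \<open>X \<union> U\<close> bounds
  \<open>card X + card U\<close> by the contribution of \<open>\<sigma>\<close>, which is at most \<open>card U\<close> by maximality, plus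
  the contributions of the other colors to \<open>X\<close>, since these do not occur on \<open>U\<close>.
\<close>

section \<open>Independence numbers\<close>

text \<open>No pair of \<open>E\<close> has both ends in \<open>Y\<close>.\<close>

definition independent :: "('a \<times> 'a) set \<Rightarrow> 'a set \<Rightarrow> bool" where
  "independent E Y \<longleftrightarrow> E \<inter> Y \<times> Y = {}"

text \<open>The maximum size of an independent subset of \<open>X\<close>, meant for finite \<open>X\<close>.\<close>

definition independence_number :: "('a \<times> 'a) set \<Rightarrow> 'a set \<Rightarrow> nat" where
  "independence_number E X = Max (card ` {Y. Y \<subseteq> X \<and> independent E Y})"

lemma independence_number_empty [simp]: "independence_number E {} = 0"
proof -
  have "{Y. Y \<subseteq> {} \<and> independent E Y} = {{}}"
    by (auto simp: independent_def)
  then show ?thesis by (simp add: independence_number_def)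
qed

lemma independence_number_attained:
  assumes "finite X"
  obtains Y where "Y \<subseteq> X" "independent E Y" "card Y = independence_number E X"
proof -
  let ?C = "{Y. Y \<subseteq> X \<and> independent E Y}"
  have "finite ?C" using assms by simp
  moreover have "{} \<in> ?C" by (simp add: independent_def)
  ultimately have "Max (card ` ?C) \<in> card ` ?C" by (intro Max_in) auto
  then show ?thesis using that by (auto simp: independence_number_def)
qed

lemma independence_number_le_card:
  assumes "finite X"
  shows "independence_number E X \<le> card X"
  by (metis assms card_mono independence_number_attained)

lemma independence_number_mono:
  assumes "finite X'" "X \<subseteq> X'"
  shows "independence_number E X \<le> independence_number E X'"
  unfolding independence_number_def
proof (rule Max_mono)
  show "card ` {Y. Y \<subseteq> X \<and> independent E Y} \<noteq> {}"
    by (auto simp: independent_def)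
qed (use assms in auto)

lemma independent_iff_card_le:
  assumes "finite X"
  shows "independent E X \<longleftrightarrow> card X \<le> independence_number E X"
proof
  assume "independent E X"
  then show "card X \<le> independence_number E X"
    unfolding independence_number_def using assms by (intro Max_ge) auto
next
  assume le: "card X \<le> independence_number E X"
  obtain Y where Y: "Y \<subseteq> X" "independent E Y" "card Y = independence_number E X"
    using independence_number_attained[OF assms] .
  then have "Y = X" using le assms by (simp add: card_seteq)
  with Y show "independent E X" by simp
qed

section \<open>List colorings when colors are private up to one vertex\<close>

text \<open>
  The third assumption says that, after any deletion of vertices and colors, some remaining color
  is the only remaining one at each vertex where it is available, apart from one vertex \<open>u\<close>. This
  \<open>u\<close> is arbitrary if there is no exception. Hall's condition is stated for the subgraphs induced
  by \<open>X \<subseteq> W\<close>.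
\<close>

lemma coloring_of_private_colors:
  fixes L :: "'a \<Rightarrow> 'c set" and E :: "('a \<times> 'a) set"
  assumes "finite S" "finite W"
    and exclusive: "\<And>S' W'. S' \<subseteq> S \<Longrightarrow> S' \<noteq> {} \<Longrightarrow> W' \<subseteq> W \<Longrightarrow>
        \<exists>\<sigma>\<in>S'. \<exists>u. \<forall>v\<in>W'. \<sigma> \<in> L v \<and> v \<noteq> u \<longrightarrow> L v \<inter> S' = {\<sigma>}"
    and hall: "\<And>X. X \<subseteq> W \<Longrightarrow> card X \<le> (\<Sum>\<sigma>\<in>S. independence_number E {v\<in>X. \<sigma> \<in> L v})"
  shows "\<exists>\<phi>. (\<forall>v\<in>W. \<phi> v \<in> S \<and> \<phi> v \<in> L v) \<and> (\<forall>(v, w)\<in>E \<inter> W \<times> W. \<phi> v \<noteq> \<phi> w)"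
  using assms
proof (induction "card S" arbitrary: S W)
  case 0
  then have "card W = 0" by fastforce
  then show ?case using "0.prems"(2) by simp
next
  case (Suc n)
  note fin = Suc.prems(1,2) and hall = Suc.prems(4)
  have "S \<noteq> {}" using Suc.hyps(2) by auto
  then obtain \<sigma> u where \<sigma>: "\<sigma> \<in> S"
    and only: "\<And>v. v \<in> W \<Longrightarrow> \<sigma> \<in> L v \<Longrightarrow> v \<noteq> u \<Longrightarrow> L v \<inter> S = {\<sigma>}"
    using Suc.prems(3)[of S W] by auto
  define S' where "S' = S - {\<sigma>}"
  define A where "A = {v\<in>W. \<sigma> \<in> L v}"
  define U where "U = A - {u}"
  have finA: "finite A" and finU: "finite U" using fin by (auto simp: A_def U_def)
  have AW: "A \<subseteq> W" and UA: "U \<subseteq> A" by (auto simp: A_def U_def)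
  have other: "{v\<in>X \<union> U. \<tau> \<in> L v} = {v\<in>X. \<tau> \<in> L v}" if "\<tau> \<in> S'" for X \<tau>
    using only that by (fastforce simp: S'_def A_def U_def)
  have split: "(\<Sum>\<tau>\<in>S. f \<tau>) = f \<sigma> + (\<Sum>\<tau>\<in>S'. f \<tau>)" for f :: "'c \<Rightarrow> nat"
    unfolding S'_def using fin(1) \<sigma> by (rule sum.remove)
  have indU: "independent E U"
  proof -
    have "card U \<le> independence_number E {v\<in>U. \<sigma> \<in> L v}
        + (\<Sum>\<tau>\<in>S'. independence_number E {v\<in>{} \<union> U. \<tau> \<in> L v})"
      using hall[of U] UA AW by (simp add: split)
    also have "(\<Sum>\<tau>\<in>S'. independence_number E {v\<in>{} \<union> U. \<tau> \<in> L v}) = 0"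
    proof (intro sum.neutral ballI)
      fix \<tau> assume "\<tau> \<in> S'"
      from other[OF this, of "{}"]
      show "independence_number E {v\<in>{} \<union> U. \<tau> \<in> L v} = 0"
        by (metis (no_types, lifting) Collect_empty_eq empty_iff independence_number_empty)
    qed
    also have "{v\<in>U. \<sigma> \<in> L v} = U" by (auto simp: U_def A_def)
    finally show ?thesis using finU by (simp add: independent_iff_card_le)
  qed
  \<comment> \<open>a maximum independent subset of \<open>A\<close> that contains \<open>U\<close>\<close>
  obtain D where D: "U \<subseteq> D" "D \<subseteq> A" "independent E D" "independence_number E A \<le> card D"
    and D_cases: "D = U \<or> D = A"
  proof (cases "independent E A")
    case True
    then show ?thesis using that[of A] UA independence_number_le_card[OF finA] by simp
  next
    case False
    then have "independence_number E A < card A" "U \<noteq> A"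
      using finA indU by (auto simp: independent_iff_card_le)
    moreover have "card A \<le> Suc (card U)"
      unfolding U_def using finA by (metis card_Suc_Diff1 Diff_empty Diff_insert0 le_SucI order_refl)
    ultimately show ?thesis using that[of U] UA indU by simp
  qed
  have finD: "finite D" using D(2) finA by (rule finite_subset)
  have hall': "card X \<le> (\<Sum>\<tau>\<in>S'. independence_number E {v\<in>X. \<tau> \<in> L v})"
    if X: "X \<subseteq> W - D" for X
    using D_cases
  proof
    assume "D = A"
    then have "{v\<in>X. \<sigma> \<in> L v} = {}" using X by (auto simp: A_def)
    moreover have "card X \<le> (\<Sum>\<tau>\<in>S. independence_number E {v\<in>X. \<tau> \<in> L v})"
      using X by (intro hall) auto
    ultimately show ?thesis by (simp only: split independence_number_empty)
  next
    assume DU: "D = U"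
    have "finite X" using X fin(2) by (meson finite_Diff finite_subset)
    then have "card X + card D = card (X \<union> D)"
      using X finD by (subst card_Un_disjoint) auto
    also have "\<dots> \<le> independence_number E {v\<in>X \<union> D. \<sigma> \<in> L v}
        + (\<Sum>\<tau>\<in>S'. independence_number E {v\<in>X \<union> U. \<tau> \<in> L v})"
      using hall[of "X \<union> D"] X D(2) AW DU by (simp add: split subset_iff)
    also have "(\<Sum>\<tau>\<in>S'. independence_number E {v\<in>X \<union> U. \<tau> \<in> L v})
        = (\<Sum>\<tau>\<in>S'. independence_number E {v\<in>X. \<tau> \<in> L v})"
      by (intro sum.cong refl) (simp only: other)
    also have "independence_number E {v\<in>X \<union> D. \<sigma> \<in> L v} \<le> independence_number E A"
      using X D(2) AW by (intro independence_number_mono finA) (auto simp: A_def)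
    also note D(4)
    finally show ?thesis by simp
  qed
  have "\<exists>\<phi>. (\<forall>v\<in>W - D. \<phi> v \<in> S' \<and> \<phi> v \<in> L v)
      \<and> (\<forall>(v, w)\<in>E \<inter> (W - D) \<times> (W - D). \<phi> v \<noteq> \<phi> w)"
  proof (rule Suc.hyps(1))
    show "n = card S'" using Suc.hyps(2) \<sigma> by (simp add: S'_def)
    show "\<exists>\<tau>\<in>S''. \<exists>u. \<forall>v\<in>W'. \<tau> \<in> L v \<and> v \<noteq> u \<longrightarrow> L v \<inter> S'' = {\<tau>}"
      if "S'' \<subseteq> S'" "S'' \<noteq> {}" "W' \<subseteq> W - D" for S'' W'
      using that by (intro Suc.prems(3)) (auto simp: S'_def)
  qed (use fin hall' in \<open>auto simp: S'_def\<close>)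
  then obtain \<phi> where \<phi>: "\<And>v. v \<in> W - D \<Longrightarrow> \<phi> v \<in> S' \<and> \<phi> v \<in> L v"
    and proper: "\<And>v w. (v, w) \<in> E \<Longrightarrow> v \<in> W - D \<Longrightarrow> w \<in> W - D \<Longrightarrow> \<phi> v \<noteq> \<phi> w"
    by blast
  define \<psi> where "\<psi> v = (if v \<in> D then \<sigma> else \<phi> v)" for v
  have "\<psi> v \<in> S \<and> \<psi> v \<in> L v" if "v \<in> W" for v
    using that \<phi>[of v] \<sigma> D(2) by (auto simp: \<psi>_def S'_def A_def)
  moreover have "\<psi> v \<noteq> \<psi> w" if "(v, w) \<in> E" "v \<in> W" "w \<in> W" for v w
    using that \<phi>[of v] \<phi>[of w] proper[of v w] D(3)
    by (auto simp: \<psi>_def S'_def independent_def)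
  ultimately show ?case by (intro exI[of _ \<psi>]) auto
qed

section \<open>Non-backtracking walks in forests\<close>

text \<open>
  The set \<open>D\<close> consists of arcs that can be continued within \<open>D\<close> without turning back. Following
  such continuations until a vertex repeats for the first time would close a cycle.
\<close>

lemma forest_no_nonbacktracking:
  assumes forest: "undirected_forest G" and D: "D \<subseteq> parcs G"
    and step: "\<And>a b. (a, b) \<in> D \<Longrightarrow> \<exists>c. c \<noteq> a \<and> (b, c) \<in> D"
  shows "D = {}"
proof (rule ccontr)
  assume "D \<noteq> {}"
  interpret pair_graph G using forest by (simp add: undirected_forest_def)
  from \<open>D \<noteq> {}\<close> have "\<exists>f. \<forall>n::nat. f n \<in> D \<and> (fst (f (Suc n)) = snd (f n) \<and> snd (f (Suc n)) \<noteq> fst (f n))"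
    by (intro dependent_nat_choice) (use step in fastforce)+
  then obtain f where f: "\<And>n::nat. f n \<in> D" "\<And>n. fst (f (Suc n)) = snd (f n)"
    "\<And>n. snd (f (Suc n)) \<noteq> fst (f n)" by blast
  define x where "x n = fst (f n)" for n
  have arc: "(x n, x (Suc n)) \<in> parcs G" for n
    using f(1)[of n] f(2)[of n] D by (auto simp: x_def)
  have nb: "x (Suc (Suc n)) \<noteq> x n" for n
    using f(2)[of "Suc n"] f(3)[of n] by (simp add: x_def)
  have "range x \<subseteq> pverts G" using arc by (auto dest: in_arcsD1)
  then have "finite (range x)" using pair_finite_verts by (rule finite_subset)
  then have "\<not> inj x" using finite_imageD infinite_UNIV_nat by metis
  then have ex: "\<exists>j. \<exists>i<j. x i = x j" unfolding inj_def by (metis linorder_neqE_nat)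
  \<comment> \<open>the first time at which the walk returns to an earlier vertex\<close>
  define j where "j = (LEAST j. \<exists>i<j. x i = x j)"
  obtain i where i: "i < j" "x i = x j" using LeastI_ex[OF ex] by (auto simp: j_def)
  have first: "x k \<noteq> x l" if "k < l" "l < j" for k l
    using not_less_Least[of l "\<lambda>j. \<exists>i<j. x i = x j"] that by (auto simp: j_def)
  define p where "p = map (\<lambda>n. (x n, x (Suc n))) [i..<j]"
  have cas: "pcas (x m) (map (\<lambda>n. (x n, x (Suc n))) [m..<m + k]) (x (m + k))" for m k
  proof (induction k arbitrary: m)
    case (Suc k)
    have "[m..<m + Suc k] = m # [Suc m..<Suc m + k]" by (simp add: upt_rec)
    then show ?case using Suc[of "Suc m"] by simp
  qed simp
  have "j \<noteq> Suc i" using arc[of i] i(2) pair_no_loops by fastforce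
  moreover have "j \<noteq> Suc (Suc i)" using nb[of i] i(2) by metis
  ultimately have len: "3 \<le> length p" using i(1) by (simp add: p_def)
  have "pcas (x i) p (x i)" using cas[of i "j - i"] i by (simp add: p_def)
  moreover have "set p \<subseteq> parcs G" using arc by (auto simp: p_def)
  moreover have "x i \<in> pverts G" using arc in_arcsD1 by blast
  ultimately have walk: "awalk (x i) p (x i)" by (simp add: awalk_def)
  then have "tl (pawalk_verts (x i) p) = map snd p"
    using len by (auto simp: awalk_verts_conv' awalk_def)
  also have "\<dots> = map (\<lambda>n. x (Suc n)) [i..<j]" by (simp add: p_def)
  finally have verts: "tl (pawalk_verts (x i) p) = map (\<lambda>n. x (Suc n)) [i..<j]" .
  have "x (Suc k) \<noteq> x (Suc l)" if "i \<le> k" "k < l" "l < j" for k l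
  proof (cases "Suc l = j")
    case True
    then show ?thesis using first[of i "Suc k"] that i(2) by auto
  next
    case False
    then show ?thesis using first[of "Suc k" "Suc l"] that by auto
  qed
  then have "inj_on (\<lambda>n. x (Suc n)) {i..<j}"
    by (intro linorder_inj_onI) auto
  then have "distinct (tl (pawalk_verts (x i) p))"
    by (simp add: verts distinct_map)
  then have "cycle p" using walk len by (auto simp: cycle_def)
  then show False using forest len by (auto simp: undirected_forest_def)
qed

text \<open>
  Colors are vertices of \<open>G\<close> as well, and \<open>S\<close> and \<open>W\<close> may overlap. This does no harm: in the
  proof, an arc whose head plays both roles has continuations of both kinds.
\<close>

lemma forest_private_color:
  assumes forest: "undirected_forest G" and "S \<noteq> {}"
  shows "\<exists>\<sigma>\<in>S. \<exists>u. \<forall>v\<in>W. \<sigma> \<in> nbhd G v \<and> v \<noteq> u \<longrightarrow> nbhd G v \<inter> S = {\<sigma>}"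
proof (rule ccontr)
  assume contr: "\<not> ?thesis"
  have neg: "\<exists>v\<in>W. \<sigma> \<in> nbhd G v \<and> v \<noteq> u \<and> nbhd G v \<inter> S \<noteq> {\<sigma>}" if "\<sigma> \<in> S" for \<sigma> u
    using contr[simplified, rule_format, OF that, of u] by auto
  interpret pair_graph G using forest by (simp add: undirected_forest_def)
  have sym: "(b, a) \<in> parcs G" if "(a, b) \<in> parcs G" for a b
    using that pair_sym_arcs by (simp add: symmetric_def symD)
  \<comment> \<open>the vertices that see at least two colors of \<open>S\<close>\<close>
  define M where "M = {v\<in>W. \<exists>\<sigma>\<in>nbhd G v \<inter> S. \<exists>\<tau>\<in>nbhd G v \<inter> S. \<sigma> \<noteq> \<tau>}"
  have other: "\<exists>v\<in>M. v \<noteq> u \<and> (\<sigma>, v) \<in> parcs G" if "\<sigma> \<in> S" for \<sigma> u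
  proof -
    obtain v where v: "v \<in> W" "\<sigma> \<in> nbhd G v" "v \<noteq> u" "nbhd G v \<inter> S \<noteq> {\<sigma>}"
      using neg[OF \<open>\<sigma> \<in> S\<close>, of u] by blast
    then obtain \<tau> where "\<tau> \<in> nbhd G v \<inter> S" "\<sigma> \<noteq> \<tau>" using \<open>\<sigma> \<in> S\<close> by auto
    then have "v \<in> M" using v that by (auto simp: M_def)
    then show ?thesis using v sym by (auto simp: nbhd_def)
  qed
  \<comment> \<open>Such an arc can be continued without turning back: if it ends in \<open>M\<close>, to another color;
    if it ends in a color, by the negated claim with its start as the exceptional vertex \<open>u\<close>.\<close>
  define D where "D = {(a, b) \<in> parcs G. a \<in> S \<and> b \<in> M \<or> a \<in> M \<and> b \<in> S}"
  have "D = {}"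
  proof (rule forest_no_nonbacktracking[OF forest])
    show "D \<subseteq> parcs G" by (auto simp: D_def)
    fix a b assume "(a, b) \<in> D"
    then consider "b \<in> M" | "b \<in> S" by (auto simp: D_def)
    then show "\<exists>c. c \<noteq> a \<and> (b, c) \<in> D"
    proof cases
      case 1
      then obtain \<sigma> \<tau> where "\<sigma> \<noteq> \<tau>" "\<sigma> \<in> S" "\<tau> \<in> S" "(b, \<sigma>) \<in> parcs G" "(b, \<tau>) \<in> parcs G"
        by (auto simp: M_def nbhd_def)
      then obtain c where "c \<noteq> a" "c \<in> S" "(b, c) \<in> parcs G" by metis
      with 1 show ?thesis by (auto simp: D_def)
    next
      case 2
      then show ?thesis using other[of b a] by (auto simp: D_def)
    qed
  qed
  moreover obtain \<sigma> where "\<sigma> \<in> S" using \<open>S \<noteq> {}\<close> by blast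
  ultimately show False using other[of \<sigma> \<sigma>] by (auto simp: D_def)
qed

section \<open>Forests are Hall-universal\<close>

text \<open>Hall's condition for the subgraph of \<open>H\<close> induced by \<open>X\<close>.\<close>

lemma hall_condition_induced:
  assumes "pair_graph H" and hall: "hall_condition S H L" and X: "X \<subseteq> pverts H"
  shows "card X \<le> (\<Sum>\<sigma>\<in>S. independence_number (parcs H) {v\<in>X. \<sigma> \<in> L v})"
proof -
  interpret pair_graph H by fact
  define F where "F = \<lparr>pverts = X, parcs = parcs H \<inter> X \<times> X\<rparr>"
  have "finite X" using X pair_finite_verts by (rule finite_subset)
  moreover have sym: "(b, a) \<in> parcs H" if "(a, b) \<in> parcs H" for a b
    using that pair_sym_arcs by (simp add: symmetric_def symD)
  ultimately have F: "pair_graph F"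
    using pair_no_loops pair_finite_arcs
    by unfold_locales (auto simp: F_def symmetric_def intro!: symI)
  then interpret F: pair_graph F .
  have "undirected_subgraph F H"
    using F X F.wf_digraph wf_digraph
    by (auto simp: undirected_subgraph_def subgraph_def compatible_def F_def)
  then have "card X \<le> (\<Sum>\<sigma>\<in>S. color_alpha F L \<sigma>)"
    using hall by (fastforce simp: hall_condition_def F_def)
  also have "color_alpha F L = (\<lambda>\<sigma>. independence_number (parcs H) {v\<in>X. \<sigma> \<in> L v})"
  proof
    fix \<sigma>
    have "{Y. independent_in F Y \<and> (\<forall>v\<in>Y. \<sigma> \<in> L v)}
        = {Y. Y \<subseteq> {v\<in>X. \<sigma> \<in> L v} \<and> independent (parcs H) Y}"
      by (auto simp: independent_in_def independent_def F_def)
    then show "color_alpha F L \<sigma> = independence_number (parcs H) {v\<in>X. \<sigma> \<in> L v}"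
      by (simp add: color_alpha_def independence_number_def)
  qed
  finally show ?thesis .
qed

theorem theorem4p11:
  fixes V :: "'a set" and G :: "'a pair_pre_digraph"
  assumes "finite V" and "G \<in> graphs_on V" and "undirected_forest G"
  shows "hall_universal G"
  unfolding hall_universal_def
proof (intro ballI impI)
  fix H assume H: "H \<in> graphs_on (pverts G)" and hall: "graph_hall_condition H G"
  have GV: "pverts G = V" using assms(2) by (simp add: graphs_on_def)
  with H have HV: "pverts H = V" and graphH: "pair_graph H" by (auto simp: graphs_on_def)
  interpret H: pair_graph H by fact
  obtain \<phi> where \<phi>: "\<forall>v\<in>V. \<phi> v \<in> V \<and> \<phi> v \<in> nbhd G v"
    and proper: "\<forall>(v, w)\<in>parcs H \<inter> V \<times> V. \<phi> v \<noteq> \<phi> w"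
  proof -
    have "\<exists>\<phi>. (\<forall>v\<in>V. \<phi> v \<in> V \<and> \<phi> v \<in> nbhd G v)
        \<and> (\<forall>(v, w)\<in>parcs H \<inter> V \<times> V. \<phi> v \<noteq> \<phi> w)"
    proof (rule coloring_of_private_colors)
      show "card X \<le> (\<Sum>\<sigma>\<in>V. independence_number (parcs H) {v\<in>X. \<sigma> \<in> nbhd G v})"
        if "X \<subseteq> V" for X
        using hall_condition_induced[OF graphH, of V "nbhd G" X] hall that
        by (simp add: graph_hall_condition_def GV HV)
    qed (use assms(1) forest_private_color[OF assms(3)] in auto)
    then show ?thesis using that by blast
  qed
  have "\<phi> v \<noteq> \<phi> w" if "(v, w) \<in> parcs H" for v w
    using that proper H.in_arcsD1[OF that] H.in_arcsD2[OF that] by (auto simp: HV)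
  with \<phi> show "graph_colorable H G"
    unfolding graph_colorable_def list_colorable_def GV HV by blast
qed

end
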